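(* For distinct integers $n,m\ge 2$, $\chi'_L(K_{n,m})=\max\{n,m\}+1$. For every integer $n\ge 2$, $\chi'_L(K_{n,n})=n+2$.
   Context: $K_{n,m}$ is the complete bipartite graph with parts of sizes $n$ and $m$. For a proper edge coloring $c:E(G)\to\{1,\dots,k\}$ of a connected graph $G$, let $\pi=(\mathcal{C}_1,\dots,\mathcal{C}_k)$ be the ordered partition of $E(G)$ into color classes. For a vertex $v$ and an edge $e=xy$, $d(v,e)=\min\{d(v,x),d(v,y)\}$, and $d(v,\mathcal{C}_i)=\min\{d(v,e): e\in\mathcal{C}_i\}$. The edge color code of $v$ is $c_\pi(v)=(d(v,\mathcal{C}_1),\dots,d(v,\mathcal{C}_k))$. The coloring $c$ is an edge-locating coloring if distinct vertices have distinct edge color codes; $\chi'_L(G)$ is the minimum $k$ for which $G$ has an edge-locating coloring with $k$ colors. *)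

theory Defs
  imports Main "HOL-Library.Extended_Nat"
begin

type_synonym 'a graph = "'a set \<times> 'a set set"

abbreviation verts :: "'a graph \<Rightarrow> 'a set" where "verts G \<equiv> fst G"
abbreviation edges :: "'a graph \<Rightarrow> 'a set set" where "edges G \<equiv> snd G"

definition simple_graph :: "'a graph \<Rightarrow> bool" where
  "simple_graph G \<longleftrightarrow> finite (verts G) \<and> (\<forall>e\<in>edges G. e \<subseteq> verts G \<and> card e = 2)"

definition walk :: "'a graph \<Rightarrow> 'a list \<Rightarrow> bool" where
  "walk G p \<longleftrightarrow> p \<noteq> [] \<and> set p \<subseteq> verts G \<and>
     (\<forall>i. Suc i < length p \<longrightarrow> {p ! i, p ! Suc i} \<in> edges G)"

definition connected_graph :: "'a graph \<Rightarrow> bool" where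
  "connected_graph G \<longleftrightarrow> simple_graph G \<and> verts G \<noteq> {} \<and>
     (\<forall>u\<in>verts G. \<forall>v\<in>verts G. \<exists>p. walk G p \<and> hd p = u \<and> last p = v)"

text \<open>
  Distances take values in \<^typ>\<open>enat\<close>, so that the infimum of an empty set is \<open>\<infinity>\<close>;
  on nonempty sets every infimum in \<^typ>\<open>enat\<close> is an attained minimum.
\<close>

definition vdist :: "'a graph \<Rightarrow> 'a \<Rightarrow> 'a \<Rightarrow> enat" where
  "vdist G u v = (INF p \<in> {p. walk G p \<and> hd p = u \<and> last p = v}. enat (length p - 1))"

definition vertex_edge_dist :: "'a graph \<Rightarrow> 'a \<Rightarrow> 'a set \<Rightarrow> enat" where
  "vertex_edge_dist G v e = (INF x \<in> e. vdist G v x)"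

definition vertex_class_dist :: "'a graph \<Rightarrow> 'a \<Rightarrow> 'a set set \<Rightarrow> enat" where
  "vertex_class_dist G v C = (INF e \<in> C. vertex_edge_dist G v e)"

text \<open>
  The color classes form a partition of the edge set, so each of the \<open>k\<close> colors is used;
  hence the image of the coloring is required to be all of \<open>{1..k}\<close>.
\<close>

definition proper_edge_coloring :: "'a graph \<Rightarrow> nat \<Rightarrow> ('a set \<Rightarrow> nat) \<Rightarrow> bool" where
  "proper_edge_coloring G k c \<longleftrightarrow> c ` edges G = {1..k} \<and>
     (\<forall>e\<in>edges G. \<forall>f\<in>edges G. e \<noteq> f \<and> e \<inter> f \<noteq> {} \<longrightarrow> c e \<noteq> c f)"

definition color_class :: "'a graph \<Rightarrow> ('a set \<Rightarrow> nat) \<Rightarrow> nat \<Rightarrow> 'a set set" where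
  "color_class G c i = {e \<in> edges G. c e = i}"

definition edge_color_code :: "'a graph \<Rightarrow> nat \<Rightarrow> ('a set \<Rightarrow> nat) \<Rightarrow> 'a \<Rightarrow> enat list" where
  "edge_color_code G k c v = map (\<lambda>i. vertex_class_dist G v (color_class G c i)) [1..<Suc k]"

definition edge_locating_coloring :: "'a graph \<Rightarrow> nat \<Rightarrow> ('a set \<Rightarrow> nat) \<Rightarrow> bool" where
  "edge_locating_coloring G k c \<longleftrightarrow>
     proper_edge_coloring G k c \<and> inj_on (edge_color_code G k c) (verts G)"

definition edge_locating_chromatic_number :: "'a graph \<Rightarrow> nat" where
  "edge_locating_chromatic_number G = (LEAST k. \<exists>c. edge_locating_coloring G k c)"

definition complete_bipartite :: "nat \<Rightarrow> nat \<Rightarrow> (nat + nat) graph" where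
  "complete_bipartite n m =
     (Inl ` {..<n} \<union> Inr ` {..<m}, {{Inl i, Inr j} | i j. i < n \<and> j < m})"

lemma connected_complete_bipartite:
  assumes "n \<ge> 1" "m \<ge> 1"
  shows "connected_graph (complete_bipartite n m)"
proof -
  let ?G = "complete_bipartite n m"
  have s: "simple_graph ?G"
    by (auto simp: simple_graph_def complete_bipartite_def)
  have E: "{Inl i, Inr j} \<in> edges ?G" "{Inr j, Inl i} \<in> edges ?G" if "i < n" "j < m" for i j
    using that by (auto simp: complete_bipartite_def insert_commute)
  have V: "Inl i \<in> verts ?G \<longleftrightarrow> i < n" "Inr j \<in> verts ?G \<longleftrightarrow> j < m" for i j
    by (auto simp: complete_bipartite_def)
  have "\<exists>p. walk ?G p \<and> hd p = u \<and> last p = v" if "u \<in> verts ?G" "v \<in> verts ?G" for u v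
  proof (cases u; cases v)
    fix i i' assume *: "u = Inl i" "v = Inl i'"
    then have "walk ?G [u, Inr 0, v]"
      using that assms V E by (auto simp: walk_def less_Suc_eq)
    then show ?thesis by (intro exI[of _ "[u, Inr 0, v]"]) simp
  next
    fix j j' assume *: "u = Inr j" "v = Inr j'"
    then have "walk ?G [u, Inl 0, v]"
      using that assms V E by (auto simp: walk_def less_Suc_eq)
    then show ?thesis by (intro exI[of _ "[u, Inl 0, v]"]) simp
  next
    fix i j assume *: "u = Inl i" "v = Inr j"
    then have "walk ?G [u, v]"
      using that assms V E by (auto simp: walk_def less_Suc_eq)
    then show ?thesis by (intro exI[of _ "[u, v]"]) simp
  next
    fix i j assume *: "u = Inr j" "v = Inl i"
    then have "walk ?G [u, v]"
      using that assms V E by (auto simp: walk_def less_Suc_eq)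
    then show ?thesis by (intro exI[of _ "[u, v]"]) simp
  qed
  moreover have "verts ?G \<noteq> {}" using assms V(1)[of 0] by auto
  ultimately show ?thesis using s by (simp add: connected_graph_def)
qed

end

theory Submission
  imports Defs
begin

text \<open>
  In a complete bipartite graph every vertex is at distance at most 1 from every edge, so an edge
  color code only records which colors occur at the vertex: a proper coloring is locating iff
  these color sets are pairwise distinct. In \<open>K\<^sub>n\<^sub>,\<^sub>m\<close> they are \<open>n\<close> sets of size \<open>m\<close> and \<open>m\<close> sets
  of size \<open>n\<close>, which gives the lower bounds by counting subsets of the \<open>k\<close> colors. For the upper
  bounds one fills an \<open>n \<times> m\<close> array. If \<open>n \<noteq> m\<close>, the entries \<open>i + j\<close> modulo
  \<open>max n m + 1\<close> work, rows and columns being distinct cyclic intervals. If \<open>n = m\<close> is odd, the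
  entries \<open>i + 2 * j\<close> modulo \<open>n + 2\<close> work: rows miss two colors at distance 2, columns
  two colors at distance 1. If \<open>n = m\<close> is even, start from \<open>i + j\<close> modulo \<open>n + 1\<close> and put a new
  color on the upper half of the antidiagonal, which separates the \<open>i\<close>-th row from the \<open>i\<close>-th
  column.
\<close>

section \<open>Codes and incident colors\<close>

text \<open>Nonzero values in \<open>enat\<close> are at least 1, so an infimum 0 must be attained.
  For empty \<open>A\<close> the infimum is infinity and both sides fail.\<close>

lemma INF_enat_eq_0_iff: "(INF x\<in>A. f x :: enat) = 0 \<longleftrightarrow> (\<exists>x\<in>A. f x = 0)"
proof
  assume *: "(INF x\<in>A. f x) = 0"
  show "\<exists>x\<in>A. f x = 0"
  proof (rule ccontr)
    assume "\<not> (\<exists>x\<in>A. f x = 0)"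
    then have "1 \<le> (INF x\<in>A. f x)"
      by (intro INF_greatest) (metis ileI1 one_eSuc zero_less_iff_neq_zero)
    with * show False by simp
  qed
next
  assume "\<exists>x\<in>A. f x = 0"
  then show "(INF x\<in>A. f x) = 0"
    by (metis INF_lower ile0_eq)
qed

lemma vdist_eq_0_iff:
  assumes "v \<in> verts G"
  shows "vdist G u v = 0 \<longleftrightarrow> u = v"
proof
  assume "vdist G u v = 0"
  then obtain p where p: "walk G p" "hd p = u" "last p = v" "enat (length p - 1) = 0"
    unfolding vdist_def INF_enat_eq_0_iff by auto
  \<comment> \<open>Truncated subtraction would also give length 0 to the empty list, which
    \<open>walk\<close> excludes.\<close>
  then have "p \<noteq> []" "length p \<le> 1" by (auto simp: walk_def zero_enat_def)
  then obtain x where "p = [x]" by (cases p) auto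
  with p show "u = v" by auto
next
  assume "u = v"
  moreover have "walk G [v]" using assms by (auto simp: walk_def)
  ultimately show "vdist G u v = 0"
    unfolding vdist_def INF_enat_eq_0_iff by (intro bexI[of _ "[v]"]) (auto simp: zero_enat_def)
qed

lemma vdist_adjacent_le_1:
  assumes "{u, v} \<in> edges G" "u \<in> verts G" "v \<in> verts G"
  shows "vdist G u v \<le> 1"
proof -
  have "walk G [u, v]" using assms by (auto simp: walk_def)
  then have "vdist G u v \<le> enat (length [u, v] - 1)"
    unfolding vdist_def by (intro INF_lower) auto
  then show ?thesis by (simp add: one_enat_def)
qed

definition incident_colors :: "'a graph \<Rightarrow> ('a set \<Rightarrow> nat) \<Rightarrow> 'a \<Rightarrow> nat set" where
  "incident_colors G c v = c ` {e \<in> edges G. v \<in> e}"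

lemma complete_bipartite_simps:
  "verts (complete_bipartite n m) = Inl ` {..<n} \<union> Inr ` {..<m}"
  "edges (complete_bipartite n m) = {{Inl i, Inr j} | i j. i < n \<and> j < m}"
  by (auto simp: complete_bipartite_def)

text \<open>Every edge has an end in the part opposite to \<open>v\<close>, and that end is adjacent
  to \<open>v\<close>.\<close>

lemma vertex_edge_dist_complete_bipartite:
  assumes "v \<in> verts (complete_bipartite n m)" "e \<in> edges (complete_bipartite n m)"
  shows "vertex_edge_dist (complete_bipartite n m) v e = (if v \<in> e then 0 else 1)"
proof -
  let ?G = "complete_bipartite n m"
  from assms(2) obtain i j where e: "e = {Inl i, Inr j}" "i < n" "j < m"
    by (auto simp: complete_bipartite_simps)
  have "e \<subseteq> verts ?G" using e by (auto simp: complete_bipartite_simps)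
  then have zero: "vertex_edge_dist ?G v e = 0 \<longleftrightarrow> v \<in> e"
    unfolding vertex_edge_dist_def INF_enat_eq_0_iff by (auto simp: vdist_eq_0_iff subset_iff)
  have "\<exists>x\<in>e. {v, x} \<in> edges ?G"
    using assms(1) e by (cases v) (auto simp: complete_bipartite_simps insert_commute)
  then obtain x where x: "x \<in> e" "{v, x} \<in> edges ?G" by blast
  have "vertex_edge_dist ?G v e \<le> vdist ?G v x"
    unfolding vertex_edge_dist_def using x by (intro INF_lower)
  also have "\<dots> \<le> 1"
    using x assms(1) \<open>e \<subseteq> verts ?G\<close> by (intro vdist_adjacent_le_1) auto
  finally show ?thesis
    using zero by (metis antisym ileI1 one_eSuc zero_less_iff_neq_zero)
qed

text \<open>The condition on \<open>t\<close> makes its class nonempty; an empty class would be at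
  distance infinity.\<close>

lemma vertex_class_dist_complete_bipartite:
  fixes c :: "(nat + nat) set \<Rightarrow> nat"
  assumes "v \<in> verts (complete_bipartite n m)" "t \<in> c ` edges (complete_bipartite n m)"
  shows "vertex_class_dist (complete_bipartite n m) v (color_class (complete_bipartite n m) c t) =
    (if t \<in> incident_colors (complete_bipartite n m) c v then 0 else 1)"
proof -
  let ?G = "complete_bipartite n m"
  let ?C = "color_class ?G c t"
  have zero: "vertex_class_dist ?G v ?C = 0 \<longleftrightarrow> t \<in> incident_colors ?G c v"
    unfolding vertex_class_dist_def INF_enat_eq_0_iff incident_colors_def
    using assms(1) by (auto simp: color_class_def vertex_edge_dist_complete_bipartite split: if_splits)
  from assms(2) obtain e where e: "e \<in> edges ?G" "c e = t" by blast
  have "vertex_class_dist ?G v ?C \<le> vertex_edge_dist ?G v e"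
    unfolding vertex_class_dist_def using e by (intro INF_lower) (auto simp: color_class_def)
  also have "\<dots> \<le> 1"
    using assms(1) e by (simp add: vertex_edge_dist_complete_bipartite)
  finally show ?thesis
    using zero by (metis antisym ileI1 one_eSuc zero_less_iff_neq_zero)
qed

lemma edge_locating_complete_bipartite_iff:
  "edge_locating_coloring (complete_bipartite n m) k c \<longleftrightarrow>
    proper_edge_coloring (complete_bipartite n m) k c \<and>
    inj_on (incident_colors (complete_bipartite n m) c) (verts (complete_bipartite n m))"
proof -
  let ?G = "complete_bipartite n m"
  have code: "edge_color_code ?G k c u = edge_color_code ?G k c v \<longleftrightarrow>
      incident_colors ?G c u = incident_colors ?G c v"
    if c: "c ` edges ?G = {1..k}" and "u \<in> verts ?G" "v \<in> verts ?G" for u v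
  proof -
    have sub: "incident_colors ?G c w \<subseteq> {1..k}" for w
      using c by (auto simp: incident_colors_def)
    have "edge_color_code ?G k c u = edge_color_code ?G k c v \<longleftrightarrow>
        (\<forall>t\<in>{1..k}. t \<in> incident_colors ?G c u \<longleftrightarrow> t \<in> incident_colors ?G c v)"
      using that by (auto simp: edge_color_code_def vertex_class_dist_complete_bipartite
          atLeastLessThanSuc_atLeastAtMost simp del: upt_Suc)
    also have "\<dots> \<longleftrightarrow> incident_colors ?G c u = incident_colors ?G c v"
      using sub[of u] sub[of v] by blast
    finally show ?thesis .
  qed
  show ?thesis
    unfolding edge_locating_coloring_def
    \<comment> \<open>The congruence rule makes properness available while the two injectivity
      claims are compared, and with it the surjectivity that \<open>code\<close> requires.\<close>
    by (rule conj_cong[OF refl]) (simp add: code inj_on_def proper_edge_coloring_def)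
qed

lemma incident_colors_complete_bipartite:
  "i < n \<Longrightarrow> incident_colors (complete_bipartite n m) c (Inl i) = (\<lambda>j. c {Inl i, Inr j}) ` {..<m}"
  "j < m \<Longrightarrow> incident_colors (complete_bipartite n m) c (Inr j) = (\<lambda>i. c {Inl i, Inr j}) ` {..<n}"
  by (auto simp: incident_colors_def complete_bipartite_simps)

section \<open>Lower bounds\<close>

lemma card_incident_colors:
  assumes "proper_edge_coloring (complete_bipartite n m) k c"
  shows "i < n \<Longrightarrow> card (incident_colors (complete_bipartite n m) c (Inl i)) = m"
    and "j < m \<Longrightarrow> card (incident_colors (complete_bipartite n m) c (Inr j)) = n"
proof -
  have ne: "c {Inl i, Inr j} \<noteq> c {Inl i', Inr j'}"
    if "i < n" "i' < n" "j < m" "j' < m" "i = i' \<and> j \<noteq> j' \<or> i \<noteq> i' \<and> j = j'" for i i' j j'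
  proof -
    have "{Inl i, Inr j} \<in> edges (complete_bipartite n m)"
      "{Inl i', Inr j'} \<in> edges (complete_bipartite n m)"
      using that by (auto simp: complete_bipartite_simps)
    moreover have "{Inl i, Inr j} \<noteq> {Inl i', Inr j'}" "{Inl i, Inr j} \<inter> {Inl i', Inr j'} \<noteq> {}"
      using that(5) by (auto simp: doubleton_eq_iff)
    ultimately show ?thesis using assms unfolding proper_edge_coloring_def by metis
  qed
  show "card (incident_colors (complete_bipartite n m) c (Inl i)) = m" if "i < n"
  proof -
    have "inj_on (\<lambda>j. c {Inl i, Inr j}) {..<m}"
      using ne[OF that that] by (intro inj_onI) force
    then show ?thesis using that by (simp add: incident_colors_complete_bipartite card_image)
  qed
  show "card (incident_colors (complete_bipartite n m) c (Inr j)) = n" if "j < m"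
  proof -
    have "inj_on (\<lambda>i. c {Inl i, Inr j}) {..<n}"
      using ne[OF _ _ that that] by (intro inj_onI) force
    then show ?thesis using that by (simp add: incident_colors_complete_bipartite card_image)
  qed
qed

text \<open>A locating coloring embeds \<open>V\<close> into the \<open>d\<close>-element subsets of
  the \<open>k\<close> colors.\<close>

lemma card_vertices_le_choose:
  assumes "edge_locating_coloring (complete_bipartite n m) k c"
    and "V \<subseteq> verts (complete_bipartite n m)"
    and "\<And>v. v \<in> V \<Longrightarrow> card (incident_colors (complete_bipartite n m) c v) = d"
  shows "card V \<le> k choose d"
proof -
  let ?G = "complete_bipartite n m"
  have "inj_on (incident_colors ?G c) V" and c: "c ` edges ?G = {1..k}"
    using assms(1,2) inj_on_subset
    by (auto simp: edge_locating_complete_bipartite_iff proper_edge_coloring_def)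
  moreover have "incident_colors ?G c ` V \<subseteq> {A. A \<subseteq> {1..k} \<and> card A = d}"
    using assms(3) c by (auto simp: incident_colors_def)
  ultimately have "card V \<le> card {A. A \<subseteq> {1..k} \<and> card A = d}"
    by (intro card_inj_on_le) auto
  then show ?thesis by (simp add: n_subsets)
qed

lemma choose_gt_1D: "1 < (k choose d) \<Longrightarrow> d < k"
  by (metis binomial_eq_0 binomial_n_n linorder_neqE_nat less_irrefl not_one_less_zero)

text \<open>Each part has at least two vertices with color sets of equal size, so more than one
  subset of that size must exist, and the size is below \<open>k\<close>.\<close>

lemma edge_locating_complete_bipartite_lower:
  assumes "n \<ge> 2" "m \<ge> 2" "edge_locating_coloring (complete_bipartite n m) k c"
  shows "max n m + 1 \<le> k"
proof -
  note card = card_incident_colors[of n m k c]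
  have proper: "proper_edge_coloring (complete_bipartite n m) k c"
    using assms(3) by (simp add: edge_locating_coloring_def)
  have "card (Inl ` {..<n} :: (nat + nat) set) \<le> k choose m"
    by (rule card_vertices_le_choose[OF assms(3)])
      (use card proper in \<open>auto simp: complete_bipartite_simps\<close>)
  then have "m < k" using assms(1) choose_gt_1D by (simp add: card_image)
  have "card (Inr ` {..<m} :: (nat + nat) set) \<le> k choose n"
    by (rule card_vertices_le_choose[OF assms(3)])
      (use card proper in \<open>auto simp: complete_bipartite_simps\<close>)
  then have "n < k" using assms(2) choose_gt_1D by (simp add: card_image)
  with \<open>m < k\<close> show ?thesis by simp
qed

text \<open>All \<open>2 * n\<close> color sets now have size \<open>n\<close>, but
  \<open>n + 1\<close> colors have only \<open>n + 1\<close> such subsets, too few for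
  \<open>n\<close> at least 2.\<close>

lemma edge_locating_complete_bipartite_lower_balanced:
  assumes "n \<ge> 2" "edge_locating_coloring (complete_bipartite n n) k c"
  shows "n + 2 \<le> k"
proof -
  have "card (verts (complete_bipartite n n)) \<le> k choose n"
    by (rule card_vertices_le_choose[OF assms(2) order_refl])
      (use card_incident_colors[of n n k c] assms(2) in
        \<open>auto simp: complete_bipartite_simps edge_locating_coloring_def\<close>)
  moreover have "card (verts (complete_bipartite n n)) = 2 * n"
    unfolding complete_bipartite_simps by (subst card_Un_disjoint) (auto simp: card_image)
  ultimately have "k \<noteq> n + 1" using assms(1) by (auto simp: binomial_symmetric[of n "Suc n"])
  with edge_locating_complete_bipartite_lower[OF assms(1,1,2)] show ?thesis by simp
qed

section \<open>Colorings from arrays\<close>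

lemma edge_locating_coloring_of_array:
  fixes f :: "nat \<Rightarrow> nat \<Rightarrow> nat"
  assumes row: "\<And>i. i < n \<Longrightarrow> inj_on (f i) {..<m}"
    and col: "\<And>j. j < m \<Longrightarrow> inj_on (\<lambda>i. f i j) {..<n}"
    and range: "\<And>i j. i < n \<Longrightarrow> j < m \<Longrightarrow> f i j < k"
    and onto: "\<And>s. s < k \<Longrightarrow> \<exists>i<n. \<exists>j<m. f i j = s"
    and rows: "inj_on (\<lambda>i. f i ` {..<m}) {..<n}"
    and cols: "inj_on (\<lambda>j. (\<lambda>i. f i j) ` {..<n}) {..<m}"
    and cross: "\<And>i j. i < n \<Longrightarrow> j < m \<Longrightarrow> f i ` {..<m} \<noteq> (\<lambda>i. f i j) ` {..<n}"
  shows "\<exists>c. edge_locating_coloring (complete_bipartite n m) k c"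
proof -
  let ?G = "complete_bipartite n m"
  \<comment> \<open>Entries start at 0 and colors at 1, hence \<open>Suc\<close>. An edge has
    exactly one end in each part, so the descriptions recover its row and column.\<close>
  define c :: "(nat + nat) set \<Rightarrow> nat"
    where "c e = Suc (f (THE i. Inl i \<in> e) (THE j. Inr j \<in> e))" for e
  have c: "c {Inl i, Inr j} = Suc (f i j)" for i j by (simp add: c_def)
  have "c ` edges ?G = {1..k}"
  proof
    show "c ` edges ?G \<subseteq> {1..k}"
      using range by (auto simp: complete_bipartite_simps c Suc_le_eq)
    show "{1..k} \<subseteq> c ` edges ?G"
    proof
      fix t assume "t \<in> {1..k}"
      then have "t - 1 < k" and "t = Suc (t - 1)" by auto
      then obtain i j where "i < n" "j < m" "t = c {Inl i, Inr j}" using onto c by metis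
      then show "t \<in> c ` edges ?G" by (auto simp: complete_bipartite_simps)
    qed
  qed
  moreover have "c e \<noteq> c e'"
    if "e \<in> edges ?G" "e' \<in> edges ?G" "e \<noteq> e'" "e \<inter> e' \<noteq> {}" for e e'
  proof -
    obtain i j i' j' where "e = {Inl i, Inr j}" "e' = {Inl i', Inr j'}"
      "i < n" "j < m" "i' < n" "j' < m"
      using \<open>e \<in> edges ?G\<close> \<open>e' \<in> edges ?G\<close> by (auto simp: complete_bipartite_simps)
    with that row[of i] col[of j] show ?thesis
      by (auto simp: c inj_on_def doubleton_eq_iff)
  qed
  ultimately have proper: "proper_edge_coloring ?G k c"
    unfolding proper_edge_coloring_def by blast
  have L: "incident_colors ?G c (Inl i) = Suc ` f i ` {..<m}" if "i < n" for i
    using that by (auto simp: incident_colors_complete_bipartite c)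
  have R: "incident_colors ?G c (Inr j) = Suc ` (\<lambda>i. f i j) ` {..<n}" if "j < m" for j
    using that by (auto simp: incident_colors_complete_bipartite c)
  have S: "Suc ` A = Suc ` B \<longleftrightarrow> A = B" for A B
    by (simp add: inj_image_eq_iff)
  have "inj_on (incident_colors ?G c) (verts ?G)"
  proof (rule inj_onI)
    fix u v assume uv: "u \<in> verts ?G" "v \<in> verts ?G"
      and eq: "incident_colors ?G c u = incident_colors ?G c v"
    show "u = v"
    proof (cases u; cases v)
      fix i i' assume *: "u = Inl i" "v = Inl i'"
      with uv have "i < n" "i' < n" by (auto simp: complete_bipartite_simps)
      with eq * rows show ?thesis by (simp add: L S inj_on_def)
    next
      fix j j' assume *: "u = Inr j" "v = Inr j'"
      with uv have "j < m" "j' < m" by (auto simp: complete_bipartite_simps)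
      with eq * cols show ?thesis by (simp add: R S inj_on_def)
    next
      fix i j assume *: "u = Inl i" "v = Inr j"
      with uv have "i < n" "j < m" by (auto simp: complete_bipartite_simps)
      with eq * cross show ?thesis by (simp add: L R S)
    next
      fix i j assume *: "u = Inr j" "v = Inl i"
      with uv have "i < n" "j < m" by (auto simp: complete_bipartite_simps)
      with eq * cross show ?thesis by (metis L R S)
    qed
  qed
  with proper show ?thesis by (auto simp: edge_locating_complete_bipartite_iff)
qed

section \<open>Cyclic arrays and unequal parts\<close>

text \<open>Turns congruences into divisibility of integer differences, free of truncated
  subtraction.\<close>

lemma nat_mod_eq_iff_int_dvd:
  fixes a b N :: nat
  shows "a mod N = b mod N \<longleftrightarrow> int N dvd int a - int b"
  by (metis mod_eq_dvd_iff of_nat_eq_iff zmod_int)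

lemma inj_on_add_mod:
  fixes N l a :: nat
  assumes "l \<le> N"
  shows "inj_on (\<lambda>t. (a + t) mod N) {..<l}"
proof (rule inj_onI)
  fix s t assume *: "s \<in> {..<l}" "t \<in> {..<l}" "(a + s) mod N = (a + t) mod N"
  then have "s mod N = t mod N" by (simp add: nat_mod_eq_iff_int_dvd)
  with * assms show "s = t" by simp
qed

text \<open>The start of a proper cyclic interval is its only element whose predecessor is missing.\<close>

lemma cyclic_interval_start_unique:
  fixes N l a b :: nat
  assumes "0 < l" "l < N" "a < N" "b < N"
    and eq: "(\<lambda>t. (a + t) mod N) ` {..<l} = (\<lambda>t. (b + t) mod N) ` {..<l}"
  shows "a = b"
proof -
  have "a \<in> (\<lambda>t. (a + t) mod N) ` {..<l}"
    using assms by (intro image_eqI[of _ _ 0]) auto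
  then obtain t where t: "t < l" "a = (b + t) mod N" using eq by auto
  show ?thesis
  proof (cases t)
    case 0
    with t assms show ?thesis by simp
  next
    case (Suc r)
    \<comment> \<open>Adding \<open>N - 1\<close> steps back by one. If \<open>a\<close> is not the
      start of the interval from \<open>b\<close>, its predecessor lies in that interval as
      well.\<close>
    have "(a + (N - 1)) mod N = (b + t + (N - 1)) mod N"
      unfolding t(2) by (simp add: mod_add_left_eq)
    also have "b + t + (N - 1) = b + r + N" using Suc assms by simp
    also have "(b + r + N) mod N = (b + r) mod N" by simp
    finally have "(a + (N - 1)) mod N \<in> (\<lambda>t. (b + t) mod N) ` {..<l}"
      using t(1) Suc by (intro image_eqI[of _ _ r]) simp_all
    then obtain s where s: "s < l" "(a + (N - 1)) mod N = (a + s) mod N"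
      unfolding eq[symmetric] by blast
    \<comment> \<open>Counted from \<open>a\<close>, the predecessor has offset
      \<open>N - 1\<close>, beyond the interval length: a contradiction.\<close>
    have "N - 1 = s"
      by (rule inj_onD[OF inj_on_add_mod[OF order_refl] s(2)]) (use s(1) assms(2) in simp_all)
    with s assms show ?thesis by simp
  qed
qed

lemma ex_edge_locating_coloring_unbalanced:
  assumes "n \<ge> 2" "m \<ge> 2" "n \<noteq> m"
  shows "\<exists>c. edge_locating_coloring (complete_bipartite n m) (max n m + 1) c"
proof -
  define N where "N = max n m + 1"
  have N: "n < N" "m < N" "0 < N" by (auto simp: N_def)
  have rowinj: "inj_on (\<lambda>j. (i + j) mod N) {..<m}" for i
    using N by (intro inj_on_add_mod) simp
  have colinj: "inj_on (\<lambda>i. (i + j) mod N) {..<n}" for j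
    using inj_on_add_mod[of n N j] N by (simp add: add.commute)
  have "\<exists>c. edge_locating_coloring (complete_bipartite n m) N c"
  proof (rule edge_locating_coloring_of_array[where f = "\<lambda>i j. (i + j) mod N"])
    \<comment> \<open>The longer line at index 0 contains every color except \<open>max n m\<close>,
      which ends the longer line at index 1.\<close>
    fix s assume s: "s < N"
    show "\<exists>i<n. \<exists>j<m. (i + j) mod N = s"
    proof (cases "n < m")
      case True
      then have "N = m + 1" by (simp add: N_def)
      with s assms show ?thesis
        by (intro exI[of _ "if s < m then 0 else 1"] conjI exI[of _ "if s < m then s else m - 1"]) auto
    next
      case False
      then have "N = n + 1" by (simp add: N_def)
      with s assms show ?thesis
        by (intro exI[of _ "if s < n then s else n - 1"] conjI exI[of _ "if s < n then 0 else 1"]) auto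
    qed
  next
    show "inj_on (\<lambda>i. (\<lambda>j. (i + j) mod N) ` {..<m}) {..<n}"
      using cyclic_interval_start_unique[of m N] assms N by (intro inj_onI) auto
    show "inj_on (\<lambda>j. (\<lambda>i. (i + j) mod N) ` {..<n}) {..<m}"
      using cyclic_interval_start_unique[of n N] assms N by (intro inj_onI) (auto simp: add.commute)
  next
    fix i j
    \<comment> \<open>A row and a column differ already in size, as \<open>n\<close> and
      \<open>m\<close> are distinct.\<close>
    have "card ((\<lambda>j. (i + j) mod N) ` {..<m}) = m" "card ((\<lambda>i. (i + j) mod N) ` {..<n}) = n"
      using rowinj colinj by (auto simp: card_image)
    then show "(\<lambda>j. (i + j) mod N) ` {..<m} \<noteq> (\<lambda>i. (i + j) mod N) ` {..<n}"
      using assms by metis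
  qed (use rowinj colinj N in auto)
  then show ?thesis by (simp add: N_def)
qed

section \<open>Missing colors and equal parts\<close>

lemma image_eq_Diff_missing:
  fixes g :: "nat \<Rightarrow> nat"
  assumes "inj_on g {..<n}" "\<And>i. i < n \<Longrightarrow> g i < k" "\<And>i. i < n \<Longrightarrow> g i \<notin> M"
    and "M \<subseteq> {..<k}" "card M + n = k"
  shows "g ` {..<n} = {..<k} - M"
proof (rule card_subset_eq)
  show "g ` {..<n} \<subseteq> {..<k} - M" using assms by auto
  have "finite M" using assms(4) finite_subset by blast
  then have "card ({..<k} - M) = k - card M" using assms(4) by (simp add: card_Diff_subset)
  also have "\<dots> = n" using assms(5) by simp
  also have "\<dots> = card (g ` {..<n})" using assms(1) by (simp add: card_image)
  finally show "card (g ` {..<n}) = card ({..<k} - M)" by simp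
qed simp

text \<open>A line of \<open>n\<close> distinct entries out of \<open>n + 2\<close> colors is the
  complement of its two missing colors, so comparing lines reduces to comparing pairs.\<close>

lemma edge_locating_coloring_of_missing:
  fixes f :: "nat \<Rightarrow> nat \<Rightarrow> nat"
  assumes row: "\<And>i. i < n \<Longrightarrow> inj_on (f i) {..<n}"
    and col: "\<And>j. j < n \<Longrightarrow> inj_on (\<lambda>i. f i j) {..<n}"
    and range: "\<And>i j. i < n \<Longrightarrow> j < n \<Longrightarrow> f i j < n + 2"
    and onto: "\<And>s. s < n + 2 \<Longrightarrow> \<exists>i<n. \<exists>j<n. f i j = s"
    and R: "\<And>i. i < n \<Longrightarrow> R i \<subseteq> {..<n + 2} \<and> card (R i) = 2"
    and C: "\<And>j. j < n \<Longrightarrow> C j \<subseteq> {..<n + 2} \<and> card (C j) = 2"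
    and missing: "\<And>i j. i < n \<Longrightarrow> j < n \<Longrightarrow> f i j \<notin> R i \<and> f i j \<notin> C j"
    and "inj_on R {..<n}" "inj_on C {..<n}"
    and cross: "\<And>i j. i < n \<Longrightarrow> j < n \<Longrightarrow> R i \<noteq> C j"
  shows "\<exists>c. edge_locating_coloring (complete_bipartite n n) (n + 2) c"
proof -
  have rows: "f i ` {..<n} = {..<n + 2} - R i" if "i < n" for i
    using R[OF that] missing[OF that]
    by (intro image_eq_Diff_missing row range that) (simp_all add: that)
  have cols: "(\<lambda>i. f i j) ` {..<n} = {..<n + 2} - C j" if "j < n" for j
    using C[OF that] missing[OF _ that]
    by (intro image_eq_Diff_missing col range that) (simp_all add: that)
  have diff: "A = B" if "{..<n + 2} - A = {..<n + 2} - B" "A \<subseteq> {..<n + 2}" "B \<subseteq> {..<n + 2}"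
    for A B :: "nat set"
    using that by blast
  show ?thesis
  proof (rule edge_locating_coloring_of_array[where f = f])
    show "inj_on (\<lambda>i. f i ` {..<n}) {..<n}"
      using \<open>inj_on R {..<n}\<close> rows R diff unfolding inj_on_def by (metis lessThan_iff)
    show "inj_on (\<lambda>j. (\<lambda>i. f i j) ` {..<n}) {..<n}"
      using \<open>inj_on C {..<n}\<close> cols C diff unfolding inj_on_def by (metis lessThan_iff)
    show "f i ` {..<n} \<noteq> (\<lambda>i. f i j) ` {..<n}" if "i < n" "j < n" for i j
      using that rows cols R C cross diff by metis
  qed (fact row col range onto)+
qed

lemma ex_edge_locating_coloring_even:
  assumes "n \<ge> 2" "even n"
  shows "\<exists>c. edge_locating_coloring (complete_bipartite n n) (n + 2) c"
proof -
  obtain h where h: "n = 2 * h" "h \<ge> 1" using assms by auto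
  \<comment> \<open>Sums stay below \<open>2 * (n + 1)\<close>, so one subtraction reduces them.
    Before recoloring, line \<open>i\<close> misses \<open>b i\<close>, the predecessor of
    \<open>i\<close> modulo \<open>n + 1\<close>. Since \<open>n = 2 * h\<close>, the recolored
    cells lie in rows below \<open>h\<close> and columns from \<open>h\<close> on; these lines lose
    \<open>n - 1\<close>, the others miss the new color \<open>n + 1\<close>.\<close>
  define f where "f i j = (if i < h \<and> i + j = n - 1 then n + 1
    else if i + j \<le> n then i + j else i + j - (n + 1))" for i j
  define b where "b i = (if i = 0 then n else i - 1)" for i
  show ?thesis
  proof (rule edge_locating_coloring_of_missing[where f = f
        and R = "\<lambda>i. {b i, if i < h then n - 1 else n + 1}"
        and C = "\<lambda>j. {b j, if j < h then n + 1 else n - 1}"])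
    fix s assume s: "s < n + 2"
    consider "s = n + 1" | "s = n" | "s = n - 1" | "s < n - 1" using s by linarith
    then show "\<exists>i<n. \<exists>j<n. f i j = s"
    proof cases
      case 1
      then show ?thesis using h by (intro exI[of _ 0] conjI exI[of _ "n - 1"]) (auto simp: f_def)
    next
      case 2
      then show ?thesis using h by (intro exI[of _ "n - 1"] conjI exI[of _ 1]) (auto simp: f_def)
    next
      case 3
      \<comment> \<open>Color \<open>n - 1\<close> survives only on the lower half of the
        antidiagonal.\<close>
      then show ?thesis using h by (intro exI[of _ "n - 1"] conjI exI[of _ 0]) (auto simp: f_def)
    next
      case 4
      then show ?thesis using h by (intro exI[of _ 0] conjI exI[of _ s]) (auto simp: f_def)
    qed
  \<comment> \<open>For indices below \<open>n\<close>, \<open>b\<close> is injective and avoids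
    \<open>n - 1\<close> and \<open>n + 1\<close>. Equal pairs thus force equal indices, and at
    equal indices row and column differ in the second color.\<close>
  qed (use h in \<open>auto simp: f_def b_def inj_on_def doubleton_eq_iff card_insert_if split: if_splits\<close>)
qed

lemma ex_edge_locating_coloring_odd:
  assumes "n \<ge> 2" "odd n"
  shows "\<exists>c. edge_locating_coloring (complete_bipartite n n) (n + 2) c"
proof -
  define N where "N = n + 2"
  have N: "N \<ge> 5" "odd N" "n < N" using assms by (auto simp: N_def elim: oddE)
  note iff = nat_mod_eq_iff_int_dvd
  have small: "x = 0" if "int N dvd x" "\<bar>x\<bar> < int N" for x
    using that zdvd_not_zless[of "\<bar>x\<bar>" "int N"] by (cases "x = 0") auto
  \<comment> \<open>As \<open>N\<close> is odd, 2 is invertible modulo \<open>N\<close>.\<close>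
  have double: "int N dvd x" if "int N dvd 2 * x" for x
    using that N(2) by (simp add: coprime_dvd_mult_right_iff)
  have pair: "{a mod N, b mod N} = {a' mod N, b' mod N} \<longleftrightarrow>
      int N dvd int a - int a' \<and> int N dvd int b - int b' \<or>
      int N dvd int a - int b' \<and> int N dvd int b - int a'" for a b a' b'
    by (simp add: doubleton_eq_iff iff)
  have not_dvd: "\<not> int N dvd d" if "d \<in> {1, 2, 3, 4}" for d
    using small[of d] that N(1) by auto
  define f where "f i j = (i + 2 * j) mod N" for i j
  \<comment> \<open>On indices below \<open>N\<close> the formula gives a Latin square. The row
    misses its entries in the cut-off columns \<open>n\<close> and \<open>n + 1\<close>, the column
    those in the cut-off rows.\<close>
  define R where "R i = {(i + 2 * n) mod N, (i + 2 * n + 2) mod N}" for i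
  define C where "C j = {(2 * j + n) mod N, (2 * j + n + 1) mod N}" for j
  \<comment> \<open>The bound \<open>N\<close> instead of \<open>n\<close> includes the cut-off
    columns.\<close>
  have row: "j = j'" if "f i j = f i j'" "j < N" "j' < N" for i j j'
  proof -
    have "int N dvd 2 * (int j - int j')" using that by (simp add: f_def iff algebra_simps)
    then have "int j - int j' = 0" using that by (intro small[OF double]) auto
    then show ?thesis by simp
  qed
  have col: "i = i'" if "f i j = f i' j" "i < N" "i' < N" for i i' j
  proof -
    have "int N dvd int i - int i'" using that by (simp add: f_def iff)
    then have "int i - int i' = 0" using that by (intro small) auto
    then show ?thesis by simp
  qed
  show ?thesis
  proof (rule edge_locating_coloring_of_missing[where f = f and R = R and C = C])
    show "inj_on (f i) {..<n}" for i using row[of i] N by (auto intro!: inj_onI)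
    show "inj_on (\<lambda>i. f i j) {..<n}" for j using col[of _ j] N by (auto intro!: inj_onI)
    show "f i j < n + 2" for i j by (simp add: f_def N_def)
    show "R i \<subseteq> {..<n + 2} \<and> card (R i) = 2" for i
      using not_dvd[of 2] iff[of "i + 2 * n + 2" N "i + 2 * n"] N(1)
      by (auto simp: R_def card_insert_if N_def)
    show "C j \<subseteq> {..<n + 2} \<and> card (C j) = 2" for j
      using not_dvd[of 1] iff[of "2 * j + n + 1" N "2 * j + n"] N(1)
      by (auto simp: C_def card_insert_if N_def)
    show "f i j \<notin> R i \<and> f i j \<notin> C j" if "i < n" "j < n" for i j
    proof -
      have "f i j \<noteq> f i n" "f i j \<noteq> f i (n + 1)"
        using row[of i j n] row[of i j "n + 1"] that by (auto simp: N_def)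
      moreover have "f i j \<noteq> f n j" "f i j \<noteq> f (n + 1) j"
        using col[of i j n] col[of i j "n + 1"] that by (auto simp: N_def)
      moreover have "R i = {f i n, f i (n + 1)}" "C j = {f n j, f (n + 1) j}"
        by (simp_all add: R_def C_def f_def algebra_simps)
      ultimately show ?thesis by simp
    qed
    show "\<exists>i<n. \<exists>j<n. f i j = s" if "s < n + 2" for s
    proof -
      \<comment> \<open>Column 0 contains the colors below \<open>n\<close>; the last two rows of
        column 1 contain the other two.\<close>
      consider "s < n" | "s = n" | "s = n + 1" using \<open>s < n + 2\<close> by linarith
      then show ?thesis
      proof cases
        case 1
        with assms show ?thesis by (intro exI[of _ s] conjI exI[of _ 0]) (auto simp: f_def N_def)
      next
        case 2
        with assms show ?thesis by (intro exI[of _ "n - 2"] conjI exI[of _ 1]) (auto simp: f_def N_def)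
      next
        case 3
        with assms show ?thesis by (intro exI[of _ "n - 1"] conjI exI[of _ 1]) (auto simp: f_def N_def)
      qed
    qed
    show "inj_on R {..<n}"
    proof (rule inj_onI)
      fix i i' assume *: "i \<in> {..<n}" "i' \<in> {..<n}" "R i = R i'"
      have "int N dvd int i - int i'"
      proof (rule ccontr)
        assume "\<not> ?thesis"
        \<comment> \<open>The pairs can then only match crosswise, which makes \<open>N\<close>
          divide 4. For columns the same argument gives 2.\<close>
        with *(3) have "int N dvd int i - int i' - 2" "int N dvd int i - int i' + 2"
          unfolding R_def pair by (auto simp: algebra_simps)
        from dvd_diff[OF this(2,1)] have "int N dvd 4" by simp
        with not_dvd show False by simp
      qed
      then have "int i - int i' = 0" using * N by (intro small) auto
      then show "i = i'" by simp
    qed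
    show "inj_on C {..<n}"
    proof (rule inj_onI)
      fix j j' assume *: "j \<in> {..<n}" "j' \<in> {..<n}" "C j = C j'"
      have "int N dvd 2 * (int j - int j')"
      proof (rule ccontr)
        assume "\<not> ?thesis"
        with *(3) have "int N dvd 2 * (int j - int j') - 1" "int N dvd 2 * (int j - int j') + 1"
          unfolding C_def pair by (auto simp: algebra_simps)
        from dvd_diff[OF this(2,1)] have "int N dvd 2" by simp
        with not_dvd show False by simp
      qed
      then have "int j - int j' = 0" using * N by (intro small[OF double]) auto
      then show "j = j'" by simp
    qed
    show "R i \<noteq> C j" for i j
    proof
      \<comment> \<open>\<open>?x\<close> is the difference of the first members. The gaps 2 and 1
        within the pairs make \<open>N\<close> divide 1 in a parallel match and 3 in a crosswise
        one.\<close>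
      let ?x = "int i + int n - 2 * int j"
      assume "R i = C j"
      then consider "int N dvd ?x" "int N dvd ?x + 1" | "int N dvd ?x - 1" "int N dvd ?x + 2"
        unfolding R_def C_def pair by (auto simp: algebra_simps)
      then show False
      proof cases
        case 1
        from dvd_diff[OF this(2,1)] have "int N dvd 1" by simp
        with not_dvd show False by blast
      next
        case 2
        from dvd_diff[OF this(2,1)] have "int N dvd 3" by simp
        with not_dvd show False by blast
      qed
    qed
  qed
qed

section \<open>Both values from matching bounds\<close>

theorem theorem4:
  "(\<forall>n m :: nat. n \<ge> 2 \<and> m \<ge> 2 \<and> n \<noteq> m \<longrightarrow>
      edge_locating_chromatic_number (complete_bipartite n m) = max n m + 1) \<and>
   (\<forall>n :: nat. n \<ge> 2 \<longrightarrow>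
      edge_locating_chromatic_number (complete_bipartite n n) = n + 2)"
proof (intro conjI allI impI)
  fix n m :: nat
  assume "n \<ge> 2 \<and> m \<ge> 2 \<and> n \<noteq> m"
  then show "edge_locating_chromatic_number (complete_bipartite n m) = max n m + 1"
    unfolding edge_locating_chromatic_number_def
    using ex_edge_locating_coloring_unbalanced edge_locating_complete_bipartite_lower
    by (intro Least_equality) blast+
next
  fix n :: nat
  assume "n \<ge> 2"
  then show "edge_locating_chromatic_number (complete_bipartite n n) = n + 2"
    unfolding edge_locating_chromatic_number_def
    using ex_edge_locating_coloring_even ex_edge_locating_coloring_odd
      edge_locating_complete_bipartite_lower_balanced
    by (intro Least_equality) blast+
qed

end
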